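(* Let $n,m\ge 2$ be integers and let $a_1,\dots,a_{n+m}$ be real numbers with $0\le a_i\le 1$ for all $i$ and $a_n+a_{n+m}\le 1$. Put $\bar a_i=1-a_i$ for $i\ne n,n+m$ and $\bar a_n=\bar a_{n+m}=1-a_n-a_{n+m}$. Put $N=n+m$, $\rho=1/N$, $r=m/N$, let $$d=\frac{1}{N-1}\sum_{i=1}^{n+m}a_i$$ be the density of vehicles, and set $$\alpha=\frac{1}{4(1-\rho)},\qquad \beta=\frac{r+\frac12-\rho}{2(1-\rho)},\qquad \gamma=\frac{r}{1-\rho}.$$ Then the nonnegative eigenvalues $\lambda$ of the junction eigenvalue problem (defined in the context), as a function of the density $d$, are given by the following table: $$\begin{array}{|c|c|c|c|c|} \hline d & 0\le d\le\alpha & \alpha\le d\le\beta & \min(\beta,\gamma)<d<\max(\beta,\gamma) & \gamma\le d\le 1\\ \hline \lambda & (1-\rho)d & \dfrac14 & \dfrac{r-(1-\rho)d}{2r-1+2\rho} & 0\\ \hline \end{array}$$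
   Context: All formulas are in ordinary (standard) arithmetic. The junction eigenvalue problem with parameters $n,m,a_i,\bar a_i$ is to find a number $\lambda$ (the eigenvalue) and a vector $q=(q_1,\dots,q_{n+m})$ such that $$\begin{cases} \lambda+q_i=\min\{a_{i-1}+q_{i-1},\ \bar a_i+q_{i+1}\}, & i\in\{1,\dots,n+m\}\setminus\{1,n,n+1,n+m\},\\ \lambda+q_n=\min\{\bar a_n+q_1+q_{n+1}-q_{n+m},\ a_{n-1}+q_{n-1}\},\\ \lambda+q_{n+m}=\min\{\bar a_{n+m}+q_1+q_{n+1}-(\lambda+q_n),\ a_{n+m-1}+q_{n+m-1}\},\\ \lambda+q_1=\min\{a_n+\tfrac12(q_n+q_{n+m}),\ \bar a_1+q_2\},\\ \lambda+q_{n+1}=\min\{a_{n+m}+\tfrac12(q_n+q_{n+m}),\ \bar a_{n+1}+q_{n+2}\}. \end{cases}$$ It is the eigenvalue problem of a model of car traffic on two circular roads, with $n$ and $m$ sections, sharing one junction.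
   Formalization: Proved with the table completed by eigenvalues it misses: λ=0 for n/(N−1) ≤ d < γ (possible only if n<m), and every 0<λ<1/4 when β=γ (n=m+2) and d=γ; all other nonnegative eigenvalues are exactly the table values. *)

theory Defs
  imports Complex_Main
begin

(* Sequences and vectors indexed by 1, ..., n+m are functions on nat; only these indices are read. *)

definition junction_eigenpair ::
  "nat \<Rightarrow> nat \<Rightarrow> (nat \<Rightarrow> real) \<Rightarrow> (nat \<Rightarrow> real) \<Rightarrow> real \<Rightarrow> (nat \<Rightarrow> real) \<Rightarrow> bool" where
  "junction_eigenpair n m a abar lam q \<longleftrightarrow>
     (\<forall>i \<in> {1..n+m} - {1, n, n+1, n+m}.
        lam + q i = min (a (i-1) + q (i-1)) (abar i + q (i+1))) \<and>
     lam + q n = min (abar n + q 1 + q (n+1) - q (n+m)) (a (n-1) + q (n-1)) \<and>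
     lam + q (n+m) =
       min (abar (n+m) + q 1 + q (n+1) - (lam + q n)) (a (n+m-1) + q (n+m-1)) \<and>
     lam + q 1 = min (a n + (1/2) * (q n + q (n+m))) (abar 1 + q 2) \<and>
     lam + q (n+1) = min (a (n+m) + (1/2) * (q n + q (n+m))) (abar (n+1) + q (n+2))"

definition junction_eigenvalue ::
  "nat \<Rightarrow> nat \<Rightarrow> (nat \<Rightarrow> real) \<Rightarrow> (nat \<Rightarrow> real) \<Rightarrow> real \<Rightarrow> bool" where
  "junction_eigenvalue n m a abar lam \<longleftrightarrow> (\<exists>q. junction_eigenpair n m a abar lam q)"

definition junction_alpha :: "real \<Rightarrow> real" where
  "junction_alpha rho = 1 / (4 * (1 - rho))"

definition junction_beta :: "real \<Rightarrow> real \<Rightarrow> real" where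
  "junction_beta rho r = (r + 1/2 - rho) / (2 * (1 - rho))"

definition junction_gamma :: "real \<Rightarrow> real \<Rightarrow> real" where
  "junction_gamma rho r = r / (1 - rho)"

(* The values listed for the density d, one disjunct per column. The columns may overlap
   (several eigenvalues for one density), so this is a set. In the third column the
   denominator is nonzero: it vanishes only if beta = gamma, and then the column is empty. *)
definition phase_table :: "real \<Rightarrow> real \<Rightarrow> real \<Rightarrow> real set" where
  "phase_table rho r d =
     (let \<alpha> = junction_alpha rho; \<beta> = junction_beta rho r; \<gamma> = junction_gamma rho r in
      {lam. (0 \<le> d \<and> d \<le> \<alpha> \<and> lam = (1 - rho) * d) \<or>
            (\<alpha> \<le> d \<and> d \<le> \<beta> \<and> lam = 1/4) \<or>
            (min \<beta> \<gamma> < d \<and> d < max \<beta> \<gamma> \<and>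
               lam = (r - (1 - rho) * d) / (2 * r - 1 + 2 * rho)) \<or>
            (\<gamma> \<le> d \<and> d \<le> 1 \<and> lam = 0)})"

(* Eigenvalues that exist but that the table does not list:
   - 0 when n/(n+m-1) <= d < gamma, where gamma = m/(n+m-1). For lam = 0 the equations of q_n
     and q_(n+m) agree and the two roads play symmetric roles, so the road of n sections can
     block the junction in the same way as the road of m sections.
     Example: n = 2, m = 3, a = (0,0,1,1,0), q = (0,-1,1,2,3), lam = 0, d = 1/2;
     the table gives 1/4 only.
   - every lam in (0,1/4) when beta = gamma (that is, n = m + 2) and d = gamma: the segment
     drawn by the third column is then vertical, its formula reads 0/0 and its range is empty.
   For all other data this set is empty. *)
definition untabulated :: "nat \<Rightarrow> nat \<Rightarrow> real \<Rightarrow> real set" where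
  "untabulated n m d =
     (let rho = 1 / real (n + m); r = real m / real (n + m);
          \<beta> = junction_beta rho r; \<gamma> = junction_gamma rho r in
      {lam. (lam = 0 \<and> real n / real (n + m - 1) \<le> d \<and> d < \<gamma>) \<or>
            (0 < lam \<and> lam < 1/4 \<and> \<beta> = \<gamma> \<and> d = \<gamma>)})"

end

theory Submission
  imports Defs
begin

text \<open>
  On each road the equations at the interior sections propagate the values at the two ends along
  edges of weight \<open>a i - lam\<close> (forwards) and \<open>1 - a i - lam\<close> (backwards). As
  \<open>lam \<le> 1/4\<close>, every two-cycle has positive weight \<open>1 - 2 * lam\<close>, so an interior
  solution exists exactly when the end values satisfy the two min-plus equations obtained by
  following a whole road. What remains is a system in the four end values. For \<open>lam > 0\<close> the
  two junction equations cannot both be tight, so the road of \<open>n\<close> sections flows freely and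
  the system can be solved; for \<open>lam = 0\<close> the two roads are symmetric and either can block
  the junction. In both cases solvability depends only on \<open>lam\<close> and the number of vehicles
  \<open>\<Sum>i. a i\<close>.
\<close>

section \<open>Elimination of the interior sections of one road\<close>

text \<open>\<open>A\<close> and \<open>B\<close> are the terms that the junction contributes at the exit \<open>t\<close>
  and at the entry \<open>s\<close> of a road.\<close>

definition road_eqs ::
  "nat \<Rightarrow> nat \<Rightarrow> (nat \<Rightarrow> real) \<Rightarrow> real \<Rightarrow> real \<Rightarrow> real \<Rightarrow> (nat \<Rightarrow> real) \<Rightarrow> bool" where
  "road_eqs s t a lam A B q \<longleftrightarrow>
     (\<forall>i \<in> {s<..<t}. lam + q i = min (a (i-1) + q (i-1)) (1 - a i + q (i+1))) \<and>
     lam + q t = min A (a (t-1) + q (t-1)) \<and>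
     lam + q s = min B (1 - a s + q (s+1))"

lemma road_eqs_cong:
  assumes "s < t" "\<And>i. i \<in> {s..t} \<Longrightarrow> q i = q' i"
  shows "road_eqs s t a lam A B q \<longleftrightarrow> road_eqs s t a lam A B q'"
proof -
  have "q t = q' t" "q (t-1) = q' (t-1)" "q s = q' s" "q (s+1) = q' (s+1)"
    using assms by auto
  moreover have "q i = q' i \<and> q (i-1) = q' (i-1) \<and> q (i+1) = q' (i+1)" if "i \<in> {s<..<t}" for i
  proof -
    have "i \<in> {s..t}" "i - 1 \<in> {s..t}" "i + 1 \<in> {s..t}"
      using that by auto
    then show ?thesis using assms(2) by blast
  qed
  ultimately show ?thesis
    unfolding road_eqs_def by (metis (no_types, lifting))
qed

text \<open>Telescoping the one-step bounds along the road bounds each end by the other. Equality is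
  carried along too: if the road term attains the minimum at one end, the term of the same direction
  attains it at every section in between.\<close>

lemma road_eqs_imp_ends:
  assumes st: "s < t" and lam: "2 * lam < 1" and road: "road_eqs s t a lam A B q"
  shows "q s = min (B - lam) (q t + (\<Sum>i=s..<t. 1 - a i - lam))"
    and "q t = min (A - lam) (q s + (\<Sum>i=s..<t. a i - lam))"
proof -
  have interior: "lam + q i = min (a (i-1) + q (i-1)) (1 - a i + q (i+1))" if "s < i" "i < t" for i
    using road that by (auto simp: road_eqs_def)
  have last: "lam + q t = min A (a (t-1) + q (t-1))"
    and first: "lam + q s = min B (1 - a s + q (s+1))"
    using road by (auto simp: road_eqs_def)
  have step_back: "q i \<le> q (Suc i) + (1 - a i - lam)" if "s \<le> i" "i < t" for i
    using interior[of i] first that by (cases "i = s") (auto simp: min_def split: if_splits)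
  have step_forw: "q (Suc i) \<le> q i + (a i - lam)" if "s \<le> i" "i < t" for i
    using interior[of "Suc i"] last that by (cases "Suc i = t") (auto simp: min_def split: if_splits)
  have tele: "(\<Sum>i=s..<t. q (Suc i) - q i) = q t - q s"
    using st by (simp add: sum_Suc_diff')
  have tele': "(\<Sum>i=s..<t. q i - q (Suc i)) = q s - q t"
    using tele by (simp add: sum_subtractf)
  have back_le: "q s \<le> q t + (\<Sum>i=s..<t. 1 - a i - lam)"
  proof -
    have "(\<Sum>i=s..<t. q i - q (Suc i)) \<le> (\<Sum>i=s..<t. 1 - a i - lam)"
      by (rule sum_mono) (use step_back in force)
    then show ?thesis using tele' by simp
  qed
  have forw_le: "q t \<le> q s + (\<Sum>i=s..<t. a i - lam)"
  proof -
    have "(\<Sum>i=s..<t. q (Suc i) - q i) \<le> (\<Sum>i=s..<t. a i - lam)"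
      by (rule sum_mono) (use step_forw in force)
    then show ?thesis using tele by simp
  qed
  \<comment> \<open>If the backward term is tight at \<open>i\<close> and the forward term at
    \<open>Suc i\<close>, adding the two equations gives \<open>2 * lam = 1\<close>. Hence backward
    tightness at \<open>s\<close> spreads through the whole road.\<close>
  have back_tight: "q s = q t + (\<Sum>i=s..<t. 1 - a i - lam)" if *: "lam + q s = 1 - a s + q (s+1)"
  proof -
    have "q i - q (Suc i) = 1 - a i - lam" if "s \<le> i" "i < t" for i
      using that
    proof (induction i rule: dec_induct)
      case base
      then show ?case using * by simp
    next
      case (step i)
      then show ?case using interior[of "Suc i"] lam by (auto simp: min_def split: if_splits)
    qed
    then have "(\<Sum>i=s..<t. q i - q (Suc i)) = (\<Sum>i=s..<t. 1 - a i - lam)"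
      by (intro sum.cong) auto
    then show ?thesis using tele' by simp
  qed
  \<comment> \<open>The mirror image, by induction from \<open>t\<close> downwards.\<close>
  have forw_tight: "q t = q s + (\<Sum>i=s..<t. a i - lam)" if *: "lam + q t = a (t-1) + q (t-1)"
  proof -
    have "q (Suc i) - q i = a i - lam" if "s \<le> i" "i \<le> t - 1" for i
      using that(2,1)
    proof (induction i rule: inc_induct)
      case base
      then show ?case using * st by simp
    next
      case (step i)
      have "s < Suc i" "Suc i < t" using step.hyps step.prems by auto
      from interior[OF this] show ?case using step lam by (auto simp: min_def split: if_splits)
    qed
    then have "(\<Sum>i=s..<t. q (Suc i) - q i) = (\<Sum>i=s..<t. a i - lam)"
      using st by (intro sum.cong) auto
    then show ?thesis using tele by simp
  qed
  show "q s = min (B - lam) (q t + (\<Sum>i=s..<t. 1 - a i - lam))"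
    using first back_le back_tight by (auto simp: min_def split: if_splits)
  show "q t = min (A - lam) (q s + (\<Sum>i=s..<t. a i - lam))"
    using last forw_le forw_tight by (auto simp: min_def split: if_splits)
qed

text \<open>The value at a section is the cheaper of the path from the entry and the path from the
  exit. A longer walk only adds two-cycles of weight \<open>1 - 2 * lam \<ge> 0\<close> and so never
  improves it.\<close>

lemma road_eqs_exists:
  assumes st: "s < t" and lam: "2 * lam \<le> 1"
    and x: "x = min (B - lam) (y + (\<Sum>i=s..<t. 1 - a i - lam))"
    and y: "y = min (A - lam) (x + (\<Sum>i=s..<t. a i - lam))"
  obtains q where "road_eqs s t a lam A B q" "q s = x" "q t = y"
proof
  define q where "q i = min (x + (\<Sum>j=s..<i. a j - lam)) (y + (\<Sum>j=i..<t. 1 - a j - lam))" for i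
  show qs: "q s = x" and qt: "q t = y"
    using x y by (simp_all add: q_def)
  define P where "P i = x + (\<Sum>j=s..<i. a j - lam)" for i
  define R where "R i = y + (\<Sum>j=i..<t. 1 - a j - lam)" for i
  have q: "q i = min (P i) (R i)" for i
    by (simp add: q_def P_def R_def)
  have P_Suc: "P (Suc i) = P i + (a i - lam)" if "s \<le> i" for i
    using that by (simp add: P_def)
  have R_Suc: "R i = R (Suc i) + (1 - a i - lam)" if "i < t" for i
    using sum.atLeast_Suc_lessThan[OF that, of "\<lambda>j. 1 - a j - lam"] by (simp add: R_def)
  \<comment> \<open>Moving one section along extends the path that runs in the same direction; the
    other path has to turn back, which costs \<open>1 - 2 * lam\<close>.\<close>
  have left: "a i + q i = lam + min (P (Suc i)) (R (Suc i) + (1 - 2 * lam))"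
    if "s \<le> i" "i < t" for i
    unfolding q using P_Suc[OF that(1)] R_Suc[OF that(2)] by linarith
  have right: "1 - a i + q (Suc i) = lam + min (P i + (1 - 2 * lam)) (R i)"
    if "s \<le> i" "i < t" for i
    unfolding q using P_Suc[OF that(1)] R_Suc[OF that(2)] by linarith
  have "lam + q i = min (a (i-1) + q (i-1)) (1 - a i + q (i+1))" if "s < i" "i < t" for i
  proof -
    have "s \<le> i - 1" "i - 1 < t" "Suc (i - 1) = i" using that by auto
    then have "a (i-1) + q (i-1) = lam + min (P i) (R i + (1 - 2 * lam))"
      using left[of "i-1"] by metis
    moreover have "1 - a i + q (i+1) = lam + min (P i + (1 - 2 * lam)) (R i)"
      using right[of i] that by simp
    ultimately show ?thesis
      using lam q[of i] by linarith
  qed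
  moreover have "lam + q t = min A (a (t-1) + q (t-1))"
  proof -
    have "s \<le> t - 1" "t - 1 < t" "Suc (t - 1) = t" using st by auto
    then have "a (t-1) + q (t-1) = lam + min (P t) (R t + (1 - 2 * lam))"
      using left[of "t-1"] by metis
    moreover have "R t = y" by (simp add: R_def)
    moreover have "y = min (A - lam) (P t)" using y by (simp add: P_def)
    ultimately show ?thesis
      using lam qt by linarith
  qed
  moreover have "lam + q s = min B (1 - a s + q (s+1))"
  proof -
    have "1 - a s + q (s+1) = lam + min (P s + (1 - 2 * lam)) (R s)"
      using right[of s] st by simp
    moreover have "P s = x" by (simp add: P_def)
    moreover have "x = min (B - lam) (R s)" using x by (simp add: R_def)
    ultimately show ?thesis
      using lam qs by linarith
  qed
  ultimately show "road_eqs s t a lam A B q"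
    by (auto simp: road_eqs_def)
qed

section \<open>Solvability of the four end equations\<close>

text \<open>\<open>x, y\<close> and \<open>z, w\<close> stand for \<open>q 1, q n\<close> and \<open>q (n+1), q (n+m)\<close>;
  \<open>c, e, f\<close> for \<open>abar n, a n, a (n+m)\<close>; \<open>F\<close> and \<open>G\<close> are the forward and
  backward weights of a road.\<close>

definition end_eqs ::
  "real \<Rightarrow> real \<Rightarrow> real \<Rightarrow> real \<Rightarrow> real \<Rightarrow> real \<Rightarrow> real \<Rightarrow> real \<Rightarrow> real \<Rightarrow> real \<Rightarrow> real \<Rightarrow> real \<Rightarrow> bool" where
  "end_eqs lam c e f F1 G1 F2 G2 x y z w \<longleftrightarrow>
     x = min (e + (1/2) * (y + w) - lam) (y + G1) \<and>
     y = min (c + x + z - w - lam) (x + F1) \<and>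
     z = min (f + (1/2) * (y + w) - lam) (w + G2) \<and>
     w = min (c + x + z - (lam + y) - lam) (z + F2)"

text \<open>At \<open>lam = 0\<close> both exit equations carry the same bound
  \<open>y + w \<le> c + x + z\<close>. If it is slack, both roads flow freely and the total forward
  weight must vanish. If it is tight, some entry is held up by its own road, and the forward bound
  of the other road gives the inequality.\<close>

lemma ex_end_eqs_zero_iff:
  assumes "c + e + f = 1" "c \<ge> 0" "F1 \<ge> 0" "G1 \<ge> 0" "F2 \<ge> 0" "G2 \<ge> 0" "F1 + G1 > 0" "F2 + G2 > 0"
    "e \<ge> 0" "f \<ge> 0"
  shows "(\<exists>x y z w. end_eqs 0 c e f F1 G1 F2 G2 x y z w) \<longleftrightarrow>
    F1 + F2 + e + f = 0 \<or> F1 + e + f \<ge> 1 + G2 \<or> F2 + e + f \<ge> 1 + G1" (is "?L \<longleftrightarrow> ?R")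
proof
  assume ?L
  then obtain x y z w where eqs: "end_eqs 0 c e f F1 G1 F2 G2 x y z w" by blast
  define h where "h = (1/2) * (y + w)"
  have h: "y + w = 2 * h" unfolding h_def by simp
  have x: "x = min (e + h) (y + G1)"
    and y: "y = min (c + x + z - w) (x + F1)"
    and z: "z = min (f + h) (w + G2)"
    and w: "w = min (c + x + z - y) (z + F2)"
    using eqs unfolding end_eqs_def diff_0_right add_0_left h_def by blast+
  show ?R
  proof (cases "y + w = c + x + z")
    case True
    consider (1) "x = e + h" "z = f + h"
      | (2) "x = e + h" "z = w + G2"
      | (3) "x = y + G1" "z = f + h"
      | (4) "x = y + G1" "z = w + G2"
      using x z unfolding min_def by metis
    then show ?thesis
    proof cases
      case 1
      \<comment> \<open>With both entries at the junction term, \<open>c + x + z\<close> exceeds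
        \<open>y + w\<close> by \<open>c + e + f = 1\<close>.\<close>
      then have False using h True assms(1) by linarith
      then show ?thesis ..
    next
      case 2
      have "y \<le> x + F1" using y by linarith
      then have "F1 + e + f \<ge> 1 + G2" using 2 h True assms(1) by linarith
      then show ?thesis by blast
    next
      case 3
      have "w \<le> z + F2" using w by linarith
      then have "F2 + e + f \<ge> 1 + G1" using 3 h True assms(1) by linarith
      then show ?thesis by blast
    next
      case 4
      \<comment> \<open>Here \<open>c + G1 + G2 = 0\<close>, so all three vanish and
        \<open>e + f = 1\<close>.\<close>
      then have "F1 + e + f \<ge> 1 + G2" using h True assms by linarith
      then show ?thesis by blast
    qed
  next
    case False
    then have yw: "y = x + F1" "w = z + F2" using y w by linarith+
    \<comment> \<open>No road is tight in both directions, as its two weights have a positive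
      sum.\<close>
    then have "x = e + h" "z = f + h"
      using x z assms(7,8) by linarith+
    then have "F1 + F2 + e + f = 0" using h yw by linarith
    then show ?thesis by blast
  qed
next
  assume ?R
  then consider "F1 + F2 + e + f = 0" | "F1 + e + f \<ge> 1 + G2" | "F2 + e + f \<ge> 1 + G1" by blast
  \<comment> \<open>The equations are invariant under adding a constant to all four values; each
    witness is normalised by \<open>y + w = 0\<close>. In the second case the entry of the second
    road is held up, in the third that of the first road.\<close>
  then show ?L
  proof cases
    case 1
    then have "end_eqs 0 c e f F1 G1 F2 G2 e (F1 + e) f (F2 + f)"
      using assms unfolding end_eqs_def min_def by simp
    then show ?thesis by blast
  next
    case 2
    then have "end_eqs 0 c e f F1 G1 F2 G2 e (1 + G2 - f) (f - 1) (f - 1 - G2)"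
      using assms unfolding end_eqs_def min_def by simp
    then show ?thesis by blast
  next
    case 3
    then have "end_eqs 0 c e f F1 G1 F2 G2 (e - 1) (e - 1 - G1) f (1 + G1 - e)"
      using assms unfolding end_eqs_def min_def by simp
    then show ?thesis by blast
  qed
qed

text \<open>The second exit equation subtracts \<open>lam\<close> once more than the first, so for
  \<open>lam > 0\<close> the first exit stays strictly below its junction term. The alternatives
  that remain are: the second entry is held up by its own road; the second road flows freely; or its
  exit meets the junction term, which forces \<open>4 * lam = 1\<close>.\<close>

lemma ex_end_eqs_pos_iff:
  assumes "lam > 0" "c + e + f = 1" "F1 + G1 > 0" "F2 + G2 > 0" "4 * lam \<le> 1"
  shows "(\<exists>x y z w. end_eqs lam c e f F1 G1 F2 G2 x y z w) \<longleftrightarrow>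
    F1 + 2 * lam = c + G2 \<or>
    F1 + 2 * lam \<le> c + G2 \<and>
      (F1 + F2 + e + f = 2 * lam \<or> 4 * lam = 1 \<and> F1 + F2 + e + f \<ge> 2 * lam)"
    (is "?L \<longleftrightarrow> ?R")
proof
  assume ?L
  then obtain x y z w where eqs: "end_eqs lam c e f F1 G1 F2 G2 x y z w" by blast
  define h where "h = (1/2) * (y + w)"
  have h: "y + w = 2 * h" unfolding h_def by simp
  have x: "x = min (e + h - lam) (y + G1)"
    and y: "y = min (c + x + z - w - lam) (x + F1)"
    and z: "z = min (f + h - lam) (w + G2)"
    and w: "w = min (c + x + z - (lam + y) - lam) (z + F2)"
    using eqs unfolding end_eqs_def h_def by blast+
  have "w \<le> c + x + z - (lam + y) - lam"
    using w by linarith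
  then have y': "y = x + F1"
    using y assms(1) by linarith
  then have x': "x = e + h - lam"
    using x assms(3) by linarith
  consider (1) "z = w + G2" "w + G2 \<le> f + h - lam"
    | (2) "z = f + h - lam" "z < w + G2"
    using z by linarith
  then show ?R
  proof cases
    case 1
    then have "F1 + 2 * lam = c + G2"
      using h x' y' w assms(2,4) by linarith
    then show ?thesis by blast
  next
    case 2
    have "F1 + 2 * lam \<le> c + G2"
      using h 2 x' y' w assms(2,4) by linarith
    moreover have "F1 + F2 + e + f = 2 * lam \<or> 4 * lam = 1 \<and> F1 + F2 + e + f \<ge> 2 * lam"
    proof (cases "w = z + F2")
      case True
      then have "F1 + F2 + e + f = 2 * lam" using h 2 x' y' by linarith
      then show ?thesis by blast
    next
      case False
      then have "4 * lam = 1" "F1 + F2 + e + f \<ge> 2 * lam"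
        using h 2 x' y' w assms(2) by linarith+
      then show ?thesis by blast
    qed
    ultimately show ?thesis by blast
  qed
next
  assume R: ?R
  \<comment> \<open>With the normalisation \<open>y + w = 0\<close>, free flow on the first road
    fixes \<open>x\<close>, \<open>y\<close> and \<open>w\<close>, and \<open>z\<close> is defined
    by its own equation. The alternatives in \<open>R\<close> serve to verify the equation for
    \<open>w\<close>, from which that for \<open>y\<close> follows by
    \<open>lam > 0\<close>.\<close>
  define z where "z = min (f - lam) (lam - e - F1 + G2)"
  have z: "z = min (f + (1/2) * (F1 + e - lam + (lam - e - F1)) - lam) (lam - e - F1 + G2)"
    unfolding z_def by simp
  have "F1 + 2 * lam \<le> c + G2"
    using R by auto
  have "lam - e - F1 = min (c + (e - lam) + z - (lam + (F1 + e - lam)) - lam) (z + F2)"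
    using R
  proof (elim conjE disjE)
    assume "F1 + 2 * lam = c + G2"
    moreover from this have "z = lam - e - F1 + G2"
      using assms(2,5) unfolding z_def by linarith
    ultimately show ?thesis using assms(4) by linarith
  next
    assume "F1 + F2 + e + f = 2 * lam"
    moreover have "z = f - lam"
      using \<open>F1 + F2 + e + f = 2 * lam\<close> assms(4) unfolding z_def by linarith
    ultimately show ?thesis using assms(2,5) by linarith
  next
    assume "4 * lam = 1" "F1 + F2 + e + f \<ge> 2 * lam"
    moreover from this have "z = f - lam"
      using \<open>F1 + 2 * lam \<le> c + G2\<close> assms(2) unfolding z_def by linarith
    ultimately show ?thesis using assms(2) by linarith
  qed
  moreover have "F1 + e - lam = min (c + (e - lam) + z - (lam - e - F1) - lam) (e - lam + F1)"
    using calculation assms(1) by linarith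
  moreover have "e - lam = min (e + (1/2) * (F1 + e - lam + (lam - e - F1)) - lam) (F1 + e - lam + G1)"
    using assms(3) by simp
  ultimately have "end_eqs lam c e f F1 G1 F2 G2 (e - lam) (F1 + e - lam) z (lam - e - F1)"
    unfolding end_eqs_def using z by blast
  then show ?L by blast
qed

section \<open>Reduction of the junction problem to the end equations\<close>

locale junction =
  fixes n m :: nat and a abar :: "nat \<Rightarrow> real"
  assumes n: "n \<ge> 2" and m: "m \<ge> 2"
    and abar: "\<And>i. i \<in> {1..n+m} - {n, n+m} \<Longrightarrow> abar i = 1 - a i"
    and abar_n: "abar n = 1 - a n - a (n+m)"
    and abar_nm: "abar (n+m) = 1 - a n - a (n+m)"
begin

lemma eigenpair_iff_road_eqs:
  "junction_eigenpair n m a abar lam q \<longleftrightarrow>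
     road_eqs 1 n a lam (1 - a n - a (n+m) + q 1 + q (n+1) - q (n+m))
       (a n + (1/2) * (q n + q (n+m))) q \<and>
     road_eqs (n+1) (n+m) a lam (1 - a n - a (n+m) + q 1 + q (n+1) - (lam + q n))
       (a (n+m) + (1/2) * (q n + q (n+m))) q"
proof -
  have dom: "{1..n+m} - {1, n, n+1, n+m} = {1<..<n} \<union> {n+1<..<n+m}"
    using n m by auto
  have "abar i = 1 - a i" if "i \<in> {1<..<n}" for i
    using that by (intro abar) auto
  then have road1: "(\<forall>i\<in>{1<..<n}. lam + q i = min (a (i-1) + q (i-1)) (abar i + q (i+1))) \<longleftrightarrow>
    (\<forall>i\<in>{1<..<n}. lam + q i = min (a (i-1) + q (i-1)) (1 - a i + q (i+1)))"
    by (intro ball_cong refl) simp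
  have "abar i = 1 - a i" if "i \<in> {n+1<..<n+m}" for i
    using that by (intro abar) auto
  then have road2: "(\<forall>i\<in>{n+1<..<n+m}. lam + q i = min (a (i-1) + q (i-1)) (abar i + q (i+1))) \<longleftrightarrow>
    (\<forall>i\<in>{n+1<..<n+m}. lam + q i = min (a (i-1) + q (i-1)) (1 - a i + q (i+1)))"
    by (intro ball_cong refl) simp
  have abar_first: "abar 1 = 1 - a 1" "abar (n+1) = 1 - a (n+1)"
    using n m by (auto intro: abar)
  have idx: "1 + 1 = (2::nat)" "n + 1 + 1 = n + 2"
    by simp_all
  show ?thesis
    unfolding junction_eigenpair_def road_eqs_def dom abar_n abar_nm ball_Un road1 road2 abar_first idx
    by blast
qed

text \<open>Adding the junction bounds at both entries and at the second exit cancels all values of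
  \<open>q\<close> and leaves \<open>4 * lam \<le> abar (n+m) + a n + a (n+m) = 1\<close>.\<close>

lemma eigenvalue_le:
  assumes "junction_eigenvalue n m a abar lam"
  shows "4 * lam \<le> 1"
proof -
  obtain q where "junction_eigenpair n m a abar lam q"
    using assms by (auto simp: junction_eigenvalue_def)
  then have "lam + q (n+m) \<le> abar (n+m) + q 1 + q (n+1) - (lam + q n)"
    "lam + q 1 \<le> a n + (1/2) * (q n + q (n+m))"
    "lam + q (n+1) \<le> a (n+m) + (1/2) * (q n + q (n+m))"
    unfolding junction_eigenpair_def by (metis min.cobounded1)+
  then show ?thesis using abar_nm by (simp add: field_simps)
qed

text \<open>The junction terms read \<open>q\<close> only at the four ends. Once these are fixed the
  two roads decouple, and solutions found on each road separately can be glued.\<close>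

lemma eigenvalue_iff_end_eqs:
  assumes lam: "2 * lam < 1"
  shows "junction_eigenvalue n m a abar lam \<longleftrightarrow>
    (\<exists>x y z w. end_eqs lam (1 - a n - a (n+m)) (a n) (a (n+m))
       (\<Sum>i=1..<n. a i - lam) (\<Sum>i=1..<n. 1 - a i - lam)
       (\<Sum>i=n+1..<n+m. a i - lam) (\<Sum>i=n+1..<n+m. 1 - a i - lam) x y z w)"
    (is "_ \<longleftrightarrow> (\<exists>x y z w. ?E x y z w)")
proof
  assume "junction_eigenvalue n m a abar lam"
  then obtain q where "junction_eigenpair n m a abar lam q"
    by (auto simp: junction_eigenvalue_def)
  then have roads: "road_eqs 1 n a lam (1 - a n - a (n+m) + q 1 + q (n+1) - q (n+m))
       (a n + (1/2) * (q n + q (n+m))) q"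
    "road_eqs (n+1) (n+m) a lam (1 - a n - a (n+m) + q 1 + q (n+1) - (lam + q n))
       (a (n+m) + (1/2) * (q n + q (n+m))) q"
    unfolding eigenpair_iff_road_eqs by blast+
  have "1 < n" "n + 1 < n + m" using n m by auto
  then have "?E (q 1) (q n) (q (n+1)) (q (n+m))"
    unfolding end_eqs_def using road_eqs_imp_ends[OF _ lam roads(1)] road_eqs_imp_ends[OF _ lam roads(2)]
    by blast
  then show "\<exists>x y z w. ?E x y z w" by blast
next
  assume "\<exists>x y z w. ?E x y z w"
  then obtain x y z w where E: "?E x y z w" by blast
  have "1 < n" "n + 1 < n + m" "2 * lam \<le> 1" using n m lam by auto
  note E = E[unfolded end_eqs_def]
  obtain q1 where q1: "q1 1 = x" "q1 n = y"
    "road_eqs 1 n a lam (1 - a n - a (n+m) + x + z - w) (a n + (1/2) * (y + w)) q1"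
    using road_eqs_exists[OF \<open>1 < n\<close> \<open>2 * lam \<le> 1\<close> E[THEN conjunct1] E[THEN conjunct2, THEN conjunct1]]
    by blast
  obtain q2 where q2: "q2 (n+1) = z" "q2 (n+m) = w"
    "road_eqs (n+1) (n+m) a lam (1 - a n - a (n+m) + x + z - (lam + y))
       (a (n+m) + (1/2) * (y + w)) q2"
    using road_eqs_exists[OF \<open>n + 1 < n + m\<close> \<open>2 * lam \<le> 1\<close>
        E[THEN conjunct2, THEN conjunct2, THEN conjunct1]
        E[THEN conjunct2, THEN conjunct2, THEN conjunct2]]
    by blast
  define q where "q i = (if i \<le> n then q1 i else q2 i)" for i
  have ends: "q 1 = x" "q n = y" "q (n+1) = z" "q (n+m) = w"
    using n m q1 q2 by (auto simp: q_def)
  have "road_eqs 1 n a lam A B q \<longleftrightarrow> road_eqs 1 n a lam A B q1" for A B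
    using n by (intro road_eqs_cong) (auto simp: q_def)
  moreover have "road_eqs (n+1) (n+m) a lam A B q \<longleftrightarrow> road_eqs (n+1) (n+m) a lam A B q2" for A B
    using m by (intro road_eqs_cong) (auto simp: q_def)
  ultimately have "junction_eigenpair n m a abar lam q"
    unfolding eigenpair_iff_road_eqs ends using q1 q2 by blast
  then show "junction_eigenvalue n m a abar lam"
    by (auto simp: junction_eigenvalue_def)
qed

section \<open>Eigenvalues in terms of the number of vehicles\<close>

lemma sum_a_split:
  "(\<Sum>i=1..n+m. a i) = (\<Sum>i=1..<n. a i) + a n + (\<Sum>i=n+1..<n+m. a i) + a (n+m)"
proof -
  have "{1..n+m} = {1..<n} \<union> {n} \<union> {n+1..<n+m} \<union> {n+m}"
    using n m by auto
  then show ?thesis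
    using m by (simp add: sum.union_disjoint Int_Un_distrib2 disjoint_iff)
qed

lemma road_sums:
  "(\<Sum>i=1..<n. a i - lam) = (\<Sum>i=1..<n. a i) - (real n - 1) * lam"
  "(\<Sum>i=1..<n. 1 - a i - lam) = (real n - 1) * (1 - lam) - (\<Sum>i=1..<n. a i)"
  "(\<Sum>i=n+1..<n+m. a i - lam) = (\<Sum>i=n+1..<n+m. a i) - (real m - 1) * lam"
  "(\<Sum>i=n+1..<n+m. 1 - a i - lam) = (real m - 1) * (1 - lam) - (\<Sum>i=n+1..<n+m. a i)"
  unfolding sum_subtractf using n m by (simp_all add: of_nat_diff algebra_simps)

text \<open>The forward weight of the first road minus the backward weight of the second contains
  the \<open>a i\<close> only through their sum over both roads, so the positions of the vehicles
  drop out.\<close>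

lemma pos_eigenvalue_iff:
  fixes lam :: real
  defines "S \<equiv> \<Sum>i=1..n+m. a i"
  assumes lam: "lam > 0"
  shows "junction_eigenvalue n m a abar lam \<longleftrightarrow>
    4 * lam \<le> 1 \<and>
    (S = real m + (real n - real m - 2) * lam \<or>
     S \<le> real m + (real n - real m - 2) * lam \<and>
       (S = (real n + real m) * lam \<or> 4 * lam = 1 \<and> S \<ge> (real n + real m) * lam))"
proof (cases "4 * lam \<le> 1")
  case True
  \<comment> \<open>This product is the sum of the forward and backward weights of a road with
    \<open>k\<close> sections: one two-cycle for each pair of neighbours.\<close>
  have F: "(real k - 1) * (1 - 2 * lam) > 0" if "k \<ge> 2" for k
    using that True lam by (intro mult_pos_pos) auto
  have gt: "(\<Sum>i=1..<n. a i - lam) + (\<Sum>i=1..<n. 1 - a i - lam) > 0"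
    "(\<Sum>i=n+1..<n+m. a i - lam) + (\<Sum>i=n+1..<n+m. 1 - a i - lam) > 0"
    using F[OF n] F[OF m] unfolding road_sums by (simp_all add: algebra_simps)
  have "2 * lam < 1" using True lam by linarith
  let ?F1 = "\<Sum>i=1..<n. a i - lam" and ?F2 = "\<Sum>i=n+1..<n+m. a i - lam"
    and ?G2 = "\<Sum>i=n+1..<n+m. 1 - a i - lam"
  have "junction_eigenvalue n m a abar lam \<longleftrightarrow>
    ?F1 + 2 * lam = 1 - a n - a (n+m) + ?G2 \<or>
    ?F1 + 2 * lam \<le> 1 - a n - a (n+m) + ?G2 \<and>
      (?F1 + ?F2 + a n + a (n+m) = 2 * lam \<or> 4 * lam = 1 \<and> ?F1 + ?F2 + a n + a (n+m) \<ge> 2 * lam)"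
    by (subst eigenvalue_iff_end_eqs[OF \<open>2 * lam < 1\<close>], rule ex_end_eqs_pos_iff[OF lam _ gt True]) simp
  moreover have "?F1 + 2 * lam = 1 - a n - a (n+m) + ?G2 \<longleftrightarrow> S = real m + (real n - real m - 2) * lam"
    "?F1 + 2 * lam \<le> 1 - a n - a (n+m) + ?G2 \<longleftrightarrow> S \<le> real m + (real n - real m - 2) * lam"
    "?F1 + ?F2 + a n + a (n+m) = 2 * lam \<longleftrightarrow> S = (real n + real m) * lam"
    "?F1 + ?F2 + a n + a (n+m) \<ge> 2 * lam \<longleftrightarrow> S \<ge> (real n + real m) * lam"
    unfolding S_def sum_a_split road_sums by (auto simp: algebra_simps)
  ultimately show ?thesis using True by blast
next
  case False
  then show ?thesis using eigenvalue_le by blast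
qed

text \<open>At \<open>lam = 0\<close> the weights count vehicles and free places. The road of
  \<open>m\<close> sections can block when the vehicles outside its first \<open>m - 1\<close>
  sections outnumber the free places there by at least one, which amounts to
  \<open>real m \<le> S\<close>; likewise for the other road.\<close>

lemma zero_eigenvalue_iff:
  defines "S \<equiv> \<Sum>i=1..n+m. a i"
  assumes a: "\<And>i. i \<in> {1..n+m} \<Longrightarrow> 0 \<le> a i \<and> a i \<le> 1" and c: "a n + a (n+m) \<le> 1"
  shows "junction_eigenvalue n m a abar 0 \<longleftrightarrow> S = 0 \<or> real m \<le> S \<or> real n \<le> S"
proof -
  have ge: "(\<Sum>i=1..<n. a i - 0) \<ge> 0" "(\<Sum>i=1..<n. 1 - a i - 0) \<ge> 0"
    "(\<Sum>i=n+1..<n+m. a i - 0) \<ge> 0" "(\<Sum>i=n+1..<n+m. 1 - a i - 0) \<ge> 0"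
    using a by (auto intro!: sum_nonneg)
  have gt: "(\<Sum>i=1..<n. a i - 0) + (\<Sum>i=1..<n. 1 - a i - 0) > 0"
    "(\<Sum>i=n+1..<n+m. a i - 0) + (\<Sum>i=n+1..<n+m. 1 - a i - 0) > 0"
    using n m unfolding road_sums by simp_all
  have ends: "a n \<ge> 0" "a (n+m) \<ge> 0" using a n m by auto
  have E: "junction_eigenvalue n m a abar 0 \<longleftrightarrow>
    (\<Sum>i=1..<n. a i - 0) + (\<Sum>i=n+1..<n+m. a i - 0) + a n + a (n+m) = 0 \<or>
    (\<Sum>i=1..<n. a i - 0) + a n + a (n+m) \<ge> 1 + (\<Sum>i=n+1..<n+m. 1 - a i - 0) \<or>
    (\<Sum>i=n+1..<n+m. a i - 0) + a n + a (n+m) \<ge> 1 + (\<Sum>i=1..<n. 1 - a i - 0)"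
    by (subst eigenvalue_iff_end_eqs, simp, rule ex_end_eqs_zero_iff[OF _ _ ge gt ends]) (use c in simp_all)
  show ?thesis
    unfolding E S_def sum_a_split road_sums by auto
qed

end

section \<open>The table in terms of the number of vehicles\<close>

text \<open>\<open>K + M - 1\<close> is also the denominator of the density, so densities and
  thresholds can be compared through their numerators.\<close>

lemma junction_thresholds:
  fixes K M :: real
  assumes "K \<ge> 2" "M \<ge> 2"
  shows "junction_alpha (1 / (K + M)) = ((K + M) / 4) / (K + M - 1)"
    and "junction_beta (1 / (K + M)) (M / (K + M)) = ((3 * M + K - 2) / 4) / (K + M - 1)"
    and "junction_gamma (1 / (K + M)) (M / (K + M)) = M / (K + M - 1)"
proof -
  define L where "L = K + M"
  have L: "L > 0" "L - 1 > 0" using assms by (auto simp: L_def)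
  have \<rho>: "1 - 1 / L = (L - 1) / L" using L by (simp add: diff_divide_distrib)
  have num: "M / L + 1/2 - 1 / L = ((3 * M + K - 2) / 2) / L"
  proof -
    have "M / L + 1/2 - 1 / L = M / L + (L / 2) / L - 1 / L"
      using L by simp
    also have "\<dots> = (M + L / 2 - 1) / L"
      by (simp only: add_divide_distrib diff_divide_distrib)
    also have "M + L / 2 - 1 = (3 * M + K - 2) / 2"
      by (simp add: L_def field_simps)
    finally show ?thesis .
  qed
  have cancel: "x / L / (y * ((L - 1) / L)) = x / y / (L - 1)" for x y
    using L by simp
  show "junction_alpha (1 / (K + M)) = ((K + M) / 4) / (K + M - 1)"
    unfolding junction_alpha_def L_def[symmetric] \<rho> using L by simp
  show "junction_beta (1 / (K + M)) (M / (K + M)) = ((3 * M + K - 2) / 4) / (K + M - 1)"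
    unfolding junction_beta_def L_def[symmetric] \<rho> num cancel by simp
  show "junction_gamma (1 / (K + M)) (M / (K + M)) = M / (K + M - 1)"
    unfolding junction_gamma_def L_def[symmetric] \<rho> using cancel[of M 1] by simp
qed

text \<open>In the third column \<open>K + M\<close> cancels and leaves the denominator
  \<open>M - K + 2\<close>. It vanishes for \<open>K = M + 2\<close>; then
  \<open>3 * M + K - 2 = 4 * M\<close> and the range of the column is empty.\<close>

lemma phase_table_iff:
  fixes K M S lam :: real
  assumes "K \<ge> 2" "M \<ge> 2"
  shows "lam \<in> phase_table (1 / (K + M)) (M / (K + M)) (S / (K + M - 1)) \<longleftrightarrow>
    0 \<le> S \<and> 4 * S \<le> K + M \<and> S = (K + M) * lam \<or>
    K + M \<le> 4 * S \<and> 4 * S \<le> 3 * M + K - 2 \<and> lam = 1/4 \<or>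
    min (3 * M + K - 2) (4 * M) < 4 * S \<and> 4 * S < max (3 * M + K - 2) (4 * M) \<and>
      lam = (M - S) / (M - K + 2) \<or>
    M \<le> S \<and> S \<le> K + M - 1 \<and> lam = 0"
proof -
  define T where "T = K + M - 1"
  have T: "T > 0" "K + M > 0" using assms by (auto simp: T_def)
  have le: "x / T \<le> y / T \<longleftrightarrow> x \<le> y" "x / T < y / T \<longleftrightarrow> x < y" "min (x / T) (y / T) = min x y / T"
    "max (x / T) (y / T) = max x y / T" for x y
    using T by (simp_all add: divide_le_cancel divide_less_cancel min_def max_def)
  have "1 - 1 / (K + M) = T / (K + M)" using T by (simp add: T_def diff_divide_distrib)
  then have lam1: "(1 - 1 / (K + M)) * (S / T) = S / (K + M)"
    using T by simp
  have lam3: "(M / (K + M) - S / (K + M)) / (2 * (M / (K + M)) - 1 + 2 * (1 / (K + M)))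
    = (M - S) / (M - K + 2)"
  proof -
    have "M / (K + M) - S / (K + M) = (M - S) / (K + M)"
      by (simp add: diff_divide_distrib)
    moreover have "2 * (M / (K + M)) - 1 + 2 * (1 / (K + M)) = (M - K + 2) / (K + M)"
    proof -
      have "2 * (M / (K + M)) - 1 + 2 * (1 / (K + M))
        = (2 * M) / (K + M) - (K + M) / (K + M) + 2 / (K + M)"
        using T by simp
      also have "\<dots> = (2 * M - (K + M) + 2) / (K + M)"
        by (simp only: add_divide_distrib diff_divide_distrib)
      finally show ?thesis by simp
    qed
    ultimately show ?thesis using T by simp
  qed
  have "0 \<le> S / T \<longleftrightarrow> 0 \<le> S" "S / T \<le> 1 \<longleftrightarrow> S \<le> T"
    using T by (simp_all add: zero_le_divide_iff)
  moreover have "lam = S / (K + M) \<longleftrightarrow> S = (K + M) * lam"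
    using T by (auto simp: field_simps)
  moreover have "(K + M) / 4 \<le> S \<longleftrightarrow> K + M \<le> 4 * S" "S \<le> (K + M) / 4 \<longleftrightarrow> 4 * S \<le> K + M"
    "S \<le> (3 * M + K - 2) / 4 \<longleftrightarrow> 4 * S \<le> 3 * M + K - 2"
    "min ((3 * M + K - 2) / 4) M < S \<longleftrightarrow> min (3 * M + K - 2) (4 * M) < 4 * S"
    "S < max ((3 * M + K - 2) / 4) M \<longleftrightarrow> 4 * S < max (3 * M + K - 2) (4 * M)"
    by (auto simp: min_def max_def)
  ultimately show ?thesis
    unfolding phase_table_def Let_def junction_thresholds[OF assms] T_def[symmetric] le lam1 lam3
      mem_Collect_eq
    by simp
qed

lemma untabulated_iff:
  assumes "n \<ge> 2" "m \<ge> 2"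
  shows "lam \<in> untabulated n m (S / (real n + real m - 1)) \<longleftrightarrow>
    lam = 0 \<and> real n \<le> S \<and> S < real m \<or>
    0 < lam \<and> lam < 1/4 \<and> real n = real m + 2 \<and> S = real m"
proof -
  define T where "T = real n + real m - 1"
  have T: "T > 0" "real (n + m - 1) = T" "real (n + m) = real n + real m"
    using assms by (auto simp: T_def)
  have nm: "real n \<ge> 2" "real m \<ge> 2" using assms by auto
  have cmp: "x / T \<le> y / T \<longleftrightarrow> x \<le> y" "x / T < y / T \<longleftrightarrow> x < y" "x / T = y / T \<longleftrightarrow> x = y" for x y
    using T by (simp_all add: divide_le_cancel divide_less_cancel)
  have "(3 * real m + real n - 2) / 4 = real m \<longleftrightarrow> real n = real m + 2"
    by auto
  then show ?thesis
    unfolding untabulated_def Let_def T(2,3) junction_thresholds[OF nm] T_def[symmetric] cmp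
      mem_Collect_eq
    by auto
qed

section \<open>Comparison of the eigenvalues with the table\<close>

theorem theorem9:
  fixes n m N :: nat and a abar :: "nat \<Rightarrow> real" and \<rho> r d :: real
  assumes "n \<ge> 2" and "m \<ge> 2"
    and "\<And>i. i \<in> {1..n+m} \<Longrightarrow> 0 \<le> a i \<and> a i \<le> 1"
    and "a n + a (n+m) \<le> 1"
    and "\<And>i. i \<in> {1..n+m} - {n, n+m} \<Longrightarrow> abar i = 1 - a i"
    and "abar n = 1 - a n - a (n+m)"
    and "abar (n+m) = 1 - a n - a (n+m)"
    and "N = n + m"
    and "\<rho> = 1 / real N"
    and "r = real m / real N"
    and "d = 1 / (real N - 1) * (\<Sum>i = 1..n+m. a i)"
  shows "phase_table \<rho> r d \<subseteq> {lam. 0 \<le> lam \<and> junction_eigenvalue n m a abar lam} \<and>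
         {lam. 0 \<le> lam \<and> junction_eigenvalue n m a abar lam} - untabulated n m d
           \<subseteq> phase_table \<rho> r d"
proof -
  interpret junction n m a abar
    using assms(1,2,5-7) by unfold_locales
  define S where "S = (\<Sum>i=1..n+m. a i)"
  define K where "K = real n"
  define M where "M = real m"
  have KM: "K \<ge> 2" "M \<ge> 2" using n m by (auto simp: K_def M_def)
  have S0: "S \<ge> 0"
    unfolding S_def by (intro sum_nonneg) (use assms(3) in auto)
  \<comment> \<open>The last sections of the two roads share a single place, so the capacity is
    \<open>K + M - 1\<close> and \<open>d \<le> 1\<close>.\<close>
  have S1: "S \<le> K + M - 1"
  proof -
    have "(\<Sum>i=1..<n. a i) \<le> (\<Sum>i=1..<n. 1)"
      by (intro sum_mono) (use assms(3) in auto)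
    moreover have "(\<Sum>i=n+1..<n+m. a i) \<le> (\<Sum>i=n+1..<n+m. 1)"
      by (intro sum_mono) (use assms(3) in auto)
    ultimately show ?thesis
      using n m assms(4) unfolding S_def sum_a_split K_def M_def by (simp add: of_nat_diff)
  qed
  have N: "real N = K + M" and d: "d = S / (K + M - 1)"
    using assms(8,11) by (simp_all add: K_def M_def S_def)
  have table: "lam \<in> phase_table \<rho> r d \<longleftrightarrow>
    0 \<le> S \<and> 4 * S \<le> K + M \<and> S = (K + M) * lam \<or>
    K + M \<le> 4 * S \<and> 4 * S \<le> 3 * M + K - 2 \<and> lam = 1/4 \<or>
    min (3 * M + K - 2) (4 * M) < 4 * S \<and> 4 * S < max (3 * M + K - 2) (4 * M) \<and>
      lam = (M - S) / (M - K + 2) \<or>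
    M \<le> S \<and> S \<le> K + M - 1 \<and> lam = 0" for lam
    using phase_table_iff[OF KM] assms(9,10) unfolding N d M_def by simp
  have untab: "lam \<in> untabulated n m d \<longleftrightarrow>
    lam = 0 \<and> K \<le> S \<and> S < M \<or> 0 < lam \<and> lam < 1/4 \<and> K = M + 2 \<and> S = M" for lam
    unfolding d K_def M_def by (rule untabulated_iff[OF n m])
  have zero: "junction_eigenvalue n m a abar 0 \<longleftrightarrow> S = 0 \<or> M \<le> S \<or> K \<le> S"
    unfolding S_def K_def M_def using zero_eigenvalue_iff assms(3,4) by blast
  have pos: "junction_eigenvalue n m a abar lam \<longleftrightarrow>
    4 * lam \<le> 1 \<and> (S = M - (M - K + 2) * lam \<or> S \<le> M - (M - K + 2) * lam \<and>
       (S = (K + M) * lam \<or> 4 * lam = 1 \<and> S \<ge> (K + M) * lam))" if "lam > 0" for lam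
  proof -
    have "real m + (real n - real m - 2) * lam = M - (M - K + 2) * lam"
      by (simp add: K_def M_def algebra_simps)
    then show ?thesis
      using pos_eigenvalue_iff[OF that] unfolding S_def K_def M_def by simp
  qed
  have sound: "0 \<le> lam \<and> junction_eigenvalue n m a abar lam" if "lam \<in> phase_table \<rho> r d" for lam
    using that unfolding table
  proof (elim disjE conjE)
    assume *: "4 * S \<le> K + M" "S = (K + M) * lam"
    then have "(K + M) * (4 * lam) \<le> (K + M) * 1" "0 \<le> (K + M) * lam"
      using S0 by (simp_all add: algebra_simps)
    then have lam: "0 \<le> lam" "4 * lam \<le> 1"
      using KM by (simp_all add: mult_le_cancel_left zero_le_mult_iff)
    show ?thesis
    proof (cases "lam = 0")
      case True
      then show ?thesis using zero * by simp
    next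
      case False
      \<comment> \<open>With \<open>S = (K + M) * lam\<close> the bound to be shown reads
        \<open>(2 * M + 2) * lam \<le> M\<close>; for \<open>lam \<le> 1/4\<close> the left side is
        at most \<open>(M + 1) / 2\<close>.\<close>
      have "(2 * M + 2) * lam \<le> (2 * M + 2) * (1/4)"
        using lam KM by (intro mult_left_mono) auto
      then have "S \<le> M - (M - K + 2) * lam"
        using * KM by (simp add: algebra_simps)
      then show ?thesis using pos[of lam] * lam False by simp
    qed
  next
    assume *: "K + M \<le> 4 * S" "4 * S \<le> 3 * M + K - 2" "lam = 1/4"
    \<comment> \<open>At \<open>lam = 1/4\<close> the two bounds in \<open>pos\<close> are
      \<open>(3 * M + K - 2) / 4\<close> and \<open>(K + M) / 4\<close>, the numerators of \<beta>
      and \<alpha>.\<close>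
    have "S \<le> M - (M - K + 2) * lam" "S \<ge> (K + M) * lam"
      unfolding *(3) using *(1,2) by (simp_all add: field_simps)
    moreover have "0 < lam" "4 * lam = 1" using *(3) by simp_all
    ultimately show ?thesis using pos by auto
  next
    assume *: "min (3 * M + K - 2) (4 * M) < 4 * S" "4 * S < max (3 * M + K - 2) (4 * M)"
      "lam = (M - S) / (M - K + 2)"
    \<comment> \<open>The sign of \<open>M - K + 2\<close> decides whether \<beta> or \<gamma> is
      the smaller threshold; the ratio \<open>lam\<close> lies strictly between 0 and 1/4 in both
      cases.\<close>
    then consider "M - K + 2 > 0" "0 < M - S" "4 * (M - S) < M - K + 2"
      | "M - K + 2 < 0" "M - S < 0" "M - K + 2 < 4 * (M - S)"
      by (auto simp: min_def max_def split: if_splits)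
    then have "0 < lam" "4 * lam \<le> 1" "S = M - (M - K + 2) * lam"
      unfolding *(3) by (cases; simp add: divide_less_eq divide_le_eq zero_less_divide_iff)+
    then show ?thesis using pos[of lam] by simp
  next
    assume "M \<le> S" "lam = 0"
    then show ?thesis using zero by simp
  qed
  have complete: "lam \<in> phase_table \<rho> r d"
    if "0 \<le> lam" "junction_eigenvalue n m a abar lam" "lam \<notin> untabulated n m d" for lam
  proof (cases "lam = 0")
    case True
    \<comment> \<open>The remaining range \<open>K \<le> S < M\<close> is the untabulated one. For
      \<open>S = 0\<close> the value 0 comes from the first column.\<close>
    then have "S = 0 \<or> M \<le> S"
      using that zero unfolding untab by auto
    then show ?thesis unfolding table using True S1 KM by auto
  next
    case False
    then have "lam > 0" using that by simp
    with that pos consider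
        (1) "4 * lam \<le> 1" "S = M - (M - K + 2) * lam"
      | (2) "4 * lam \<le> 1" "S = (K + M) * lam"
      | (3) "S \<le> M - (M - K + 2) * lam" "4 * lam = 1" "S \<ge> (K + M) * lam"
      by blast
    then show ?thesis
    proof cases
      case 1
      show ?thesis
      \<comment> \<open>On this branch \<open>S\<close> is affine in \<open>lam\<close>, from
        \<open>M\<close> at 0 to \<open>(3 * M + K - 2) / 4\<close> at 1/4. The latter end lies in
        the second column, the open segment in the third.\<close>
      proof (cases "lam = 1/4")
        case True
        have "4 * S = 3 * M + K - 2"
          using 1(2) unfolding True by (simp add: field_simps)
        with True KM show ?thesis unfolding table by auto
      next
        case False
        then have lt: "lam < 1/4" using 1 by simp
        \<comment> \<open>For \<open>K = M + 2\<close> the segment is vertical: \<open>S = M\<close>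
          for every \<open>lam\<close> on it, which is the second untabulated case.\<close>
        then have D: "M - K + 2 \<noteq> 0"
          using 1 that \<open>lam > 0\<close> unfolding untab by auto
        have "lam = (M - S) / (M - K + 2)" using 1 D by simp
        moreover have "min (3 * M + K - 2) (4 * M) < 4 * S \<and> 4 * S < max (3 * M + K - 2) (4 * M)"
        proof (cases "M - K + 2 > 0")
          case True
          then have "(M - K + 2) * lam > 0" "(M - K + 2) * lam < (M - K + 2) * (1/4)"
            using \<open>lam > 0\<close> lt by (simp, intro mult_strict_left_mono)
          then show ?thesis using 1 by (simp add: min_def max_def)
        next
          case False
          with D have "M - K + 2 < 0" by simp
          then have "(M - K + 2) * lam < 0" "(M - K + 2) * lam > (M - K + 2) * (1/4)"
            using \<open>lam > 0\<close> lt by (simp add: mult_less_0_iff, intro mult_strict_left_mono_neg)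
          then show ?thesis using 1(2) by (simp add: min_def max_def mult.commute)
        qed
        ultimately show ?thesis unfolding table by blast
      qed
    next
      case 2
      then have "4 * S \<le> K + M"
        using mult_left_mono[of "4 * lam" 1 "K + M"] KM by simp
      then show ?thesis unfolding table using 2 S0 by blast
    next
      case 3
      then have lam: "lam = 1/4" by simp
      have "4 * S \<le> 3 * M + K - 2" "K + M \<le> 4 * S"
        using 3(1,3) unfolding lam by (simp_all add: field_simps)
      then show ?thesis unfolding table using lam by blast
    qed
  qed
  show ?thesis using sound complete by blast
qed

end
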